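(* Let $\mathcal{A}$ be a unital C*-algebra, let $\mathcal{E}$ be a finite rank (left) Hilbert C*-module over $\mathcal{A}$, and let $\{\tau_j\}_{j=1}^n$ be a unit inner product frame for $\mathcal{E}$. If $x\in\mathcal{E}$ can be written as $x=\theta_\tau^* c$ for some $c\in\mathcal{A}^n$ satisfying $$\|c\|_0<\frac{1}{2}\left(1+\frac{1}{\displaystyle\max_{1\leq j,k\leq n,\ j\neq k}\|\langle \tau_j,\tau_k\rangle\|}\right),$$ then $c$ is the unique solution to the problem $$\text{minimize }\{\|d\|_0: d\in\mathcal{A}^n\}\quad\text{subject to}\quad \theta_\tau^* d=x;$$ that is, $\theta_\tau^*c=x$ and every $d\in\mathcal{A}^n$ with $\theta_\tau^*d=x$ and $d\neq c$ satisfies $\|d\|_0>\|c\|_0$.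
   Context: A (left) Hilbert C*-module over a unital C*-algebra $\mathcal{A}$ is a left $\mathcal{A}$-module $\mathcal{E}$ with a map $\langle\cdot,\cdot\rangle:\mathcal{E}\times\mathcal{E}\to\mathcal{A}$ such that for all $x,y,z\in\mathcal{E}$, $a\in\mathcal{A}$: (i) $\langle x,x\rangle\geq 0$, and $\langle x,x\rangle=0$ implies $x=0$; (ii) $\langle x+y,z\rangle=\langle x,z\rangle+\langle y,z\rangle$; (iii) $\langle ax,y\rangle=a\langle x,y\rangle$; (iv) $\langle x,y\rangle=\langle y,x\rangle^*$; (v) $\mathcal{E}$ is complete for the norm $\|x\|=\sqrt{\|\langle x,x\rangle\|}$. Finite rank is understood as finitely generated (this holds automatically when a finite frame exists). A finite collection $\{\tau_j\}_{j=1}^n$ in $\mathcal{E}$ is a (modular) frame for $\mathcal{E}$ if there are real $a,b>0$ with $a\langle x,x\rangle\leq\sum_{j=1}^n\langle x,\tau_j\rangle\langle\tau_j,x\rangle\leq b\langle x,x\rangle$ for all $x\in\mathcal{E}$ (order in $\mathcal{A}$). It is a unit inner product frame if moreover $\langle\tau_j,\tau_j\rangle=1$ (the identity of $\mathcal{A}$) for all $1\leq j\leq n$. The modular synthesis morphism is $\theta_\tau^*:\mathcal{A}^n\to\mathcal{E}$, $\theta_\tau^*(a_j)_{j=1}^n=\sum_{j=1}^n a_j\tau_j$. For $d\in\mathcal{A}^n$, $\|d\|_0$ is the number of nonzero entries of $d$. Convention: if the maximum in the hypothesis is $0$ (or is over the empty set, when $n=1$), its reciprocal is read as $+\infty$,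 so the hypothesis on $\|c\|_0$ holds for every $c$. *)

theory Defs
  imports "HOL-Analysis.Analysis" "HOL-Library.Extended_Real"
begin

(* The unit is taken from monoid_mult rather than ring_1, so that the zero algebra is not
   excluded.  The real scalar multiplication inherited from the library is the restriction of
   the complex one. *)
class unital_cstar_algebra = real_normed_algebra + banach + monoid_mult +
  fixes scaleC :: "complex \<Rightarrow> 'a \<Rightarrow> 'a"  (infixr "*\<^sub>C" 75)
    and adj :: "'a \<Rightarrow> 'a"
  assumes scaleC_add_right: "s *\<^sub>C (a + b) = s *\<^sub>C a + s *\<^sub>C b"
    and scaleC_add_left: "(s + t) *\<^sub>C a = s *\<^sub>C a + t *\<^sub>C a"
    and scaleC_scaleC: "s *\<^sub>C t *\<^sub>C a = (s * t) *\<^sub>C a"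
    and scaleC_of_real: "complex_of_real r *\<^sub>C a = r *\<^sub>R a"
    and scaleC_mult_left: "(s *\<^sub>C a) * b = s *\<^sub>C (a * b)"
    and scaleC_mult_right: "a * (s *\<^sub>C b) = s *\<^sub>C (a * b)"
    and norm_scaleC: "norm (s *\<^sub>C a) = cmod s * norm a"
    and adj_add: "adj (a + b) = adj a + adj b"
    and adj_scaleC: "adj (s *\<^sub>C a) = cnj s *\<^sub>C adj a"
    and adj_mult: "adj (a * b) = adj b * adj a"
    and adj_adj: "adj (adj a) = a"
    and cstar_identity: "norm (adj a * a) = (norm a)\<^sup>2"

definition cstar_spectrum :: "'a::unital_cstar_algebra \<Rightarrow> complex set" where
  "cstar_spectrum a = {s. \<not> (\<exists>b. (a - s *\<^sub>C 1) * b = 1 \<and> b * (a - s *\<^sub>C 1) = 1)}"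

definition cstar_positive :: "'a::unital_cstar_algebra \<Rightarrow> bool" where
  "cstar_positive a \<longleftrightarrow> adj a = a \<and> cstar_spectrum a \<subseteq> complex_of_real ` {0..}"

definition cstar_le :: "'a::unital_cstar_algebra \<Rightarrow> 'a \<Rightarrow> bool"  (infix "\<preceq>" 50) where
  "a \<preceq> b \<longleftrightarrow> cstar_positive (b - a)"

definition module_norm :: "('e \<Rightarrow> 'e \<Rightarrow> 'a::unital_cstar_algebra) \<Rightarrow> 'e \<Rightarrow> real" where
  "module_norm ip x = sqrt (norm (ip x x))"

locale hilbert_cstar_module =
  fixes act :: "'a::unital_cstar_algebra \<Rightarrow> 'e::ab_group_add \<Rightarrow> 'e"
    and ip :: "'e \<Rightarrow> 'e \<Rightarrow> 'a"
  assumes act_add_right: "act a (x + y) = act a x + act a y"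
    and act_add_left: "act (a + b) x = act a x + act b x"
    and act_mult: "act (a * b) x = act a (act b x)"
    and act_one: "act 1 x = x"
    and ip_positive: "0 \<preceq> ip x x"
    and ip_definite: "ip x x = 0 \<Longrightarrow> x = 0"
    and ip_add_left: "ip (x + y) z = ip x z + ip y z"
    and ip_act_left: "ip (act a x) y = a * ip x y"
    and ip_adj: "ip x y = adj (ip y x)"
    and complete:
      "(\<forall>e>0. \<exists>N. \<forall>m\<ge>N. \<forall>k\<ge>N. module_norm ip (X m - X k) < e) \<Longrightarrow>
        \<exists>l. (\<lambda>m. module_norm ip (X m - l)) \<longlonglongrightarrow> 0"

definition finitely_generated ::
    "('a::unital_cstar_algebra \<Rightarrow> 'e::ab_group_add \<Rightarrow> 'e) \<Rightarrow> bool" where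
  "finitely_generated act \<longleftrightarrow> (\<exists>S. finite S \<and> (\<forall>x. \<exists>f. x = (\<Sum>s\<in>S. act (f s) s)))"

definition modular_frame ::
    "('e \<Rightarrow> 'e \<Rightarrow> 'a::unital_cstar_algebra) \<Rightarrow> ('n::finite \<Rightarrow> 'e) \<Rightarrow> bool" where
  "modular_frame ip \<tau> \<longleftrightarrow>
    (\<exists>a b :: real. 0 < a \<and> 0 < b \<and>
      (\<forall>x. a *\<^sub>R ip x x \<preceq> (\<Sum>j\<in>UNIV. ip x (\<tau> j) * ip (\<tau> j) x) \<and>
           (\<Sum>j\<in>UNIV. ip x (\<tau> j) * ip (\<tau> j) x) \<preceq> b *\<^sub>R ip x x))"

definition unit_inner_product_frame ::
    "('e \<Rightarrow> 'e \<Rightarrow> 'a::unital_cstar_algebra) \<Rightarrow> ('n::finite \<Rightarrow> 'e) \<Rightarrow> bool" where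
  "unit_inner_product_frame ip \<tau> \<longleftrightarrow> modular_frame ip \<tau> \<and> (\<forall>j. ip (\<tau> j) (\<tau> j) = 1)"

definition synthesis ::
    "('a::unital_cstar_algebra \<Rightarrow> 'e::ab_group_add \<Rightarrow> 'e) \<Rightarrow> ('n::finite \<Rightarrow> 'e) \<Rightarrow> 'a ^ 'n \<Rightarrow> 'e" where
  "synthesis act \<tau> c = (\<Sum>j\<in>UNIV. act (c $ j) (\<tau> j))"

definition l0_norm :: "'a::zero ^ 'n::finite \<Rightarrow> nat" where
  "l0_norm d = card {j. d $ j \<noteq> 0}"

(* The inserted 0 does not affect the maximum of a nonempty set of norms; it only fixes the
   value 0 for a one-element family, where there are no pairs of distinct indices. *)
definition coherence ::
    "('e \<Rightarrow> 'e \<Rightarrow> 'a::unital_cstar_algebra) \<Rightarrow> ('n::finite \<Rightarrow> 'e) \<Rightarrow> real" where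
  "coherence ip \<tau> = Max (insert 0 {norm (ip (\<tau> j) (\<tau> k)) | j k. j \<noteq> k})"

(* Division is that of the extended reals, where 1 / 0 = \<infinity>. *)
definition sparsity_bound ::
    "('e \<Rightarrow> 'e \<Rightarrow> 'a::unital_cstar_algebra) \<Rightarrow> ('n::finite \<Rightarrow> 'e) \<Rightarrow> ereal" where
  "sparsity_bound ip \<tau> = 1 / 2 * (1 + 1 / ereal (coherence ip \<tau>))"

end

theory Submission
  imports Defs
begin

text \<open>
  Let \<open>M\<close> be the coherence. If \<open>e\<close> lies in the kernel of the synthesis morphism, taking the inner
  product of \<open>\<Sum>\<^sub>j e\<^sub>j \<tau>\<^sub>j = 0\<close> with \<open>\<tau>\<^sub>k\<close> isolates \<open>e\<^sub>k\<close>, because \<open>\<langle>\<tau>\<^sub>k, \<tau>\<^sub>k\<rangle> = 1\<close>, and yields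
  \<open>(1 + M) \<parallel>e\<^sub>k\<parallel> \<le> M \<Sum>\<^sub>j \<parallel>e\<^sub>j\<parallel>\<close>. Summing over the support of \<open>e\<close> gives \<open>1 + M \<le> M \<parallel>e\<parallel>\<^sub>0\<close> unless \<open>e = 0\<close>.
  Apply this to the difference of two representations of the same vector, whose support has at
  most \<open>\<parallel>c\<parallel>\<^sub>0 + \<parallel>d\<parallel>\<^sub>0\<close> elements.
\<close>

text \<open>\<open>Max_ge\<close> requires finiteness; here there are only finitely many index
  pairs.\<close>

lemma finite_inner_product_norms: "finite {norm (ip (\<tau> j) (\<tau> k)) | j k. j \<noteq> k}"
  for \<tau> :: "'n::finite \<Rightarrow> 'e" and ip :: "'e \<Rightarrow> 'e \<Rightarrow> 'a::real_normed_vector"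
  by (rule finite_subset[of _ "range (\<lambda>(j, k). norm (ip (\<tau> j) (\<tau> k)))"]) auto

lemma coherence_nonneg: "0 \<le> coherence ip \<tau>"
  for \<tau> :: "'n::finite \<Rightarrow> 'e" and ip :: "'e \<Rightarrow> 'e \<Rightarrow> 'a::unital_cstar_algebra"
  unfolding coherence_def by (rule Max_ge) (simp_all add: finite_inner_product_norms)

lemma norm_ip_le_coherence: "norm (ip (\<tau> j) (\<tau> k)) \<le> coherence ip \<tau>" if "j \<noteq> k"
  for \<tau> :: "'n::finite \<Rightarrow> 'e" and ip :: "'e \<Rightarrow> 'e \<Rightarrow> 'a::unital_cstar_algebra"
  unfolding coherence_def using that by (intro Max_ge) (auto simp: finite_inner_product_norms)

text \<open>Clears the denominator of the sparsity hypothesis. At coherence 0 the bound is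
  \<infinity> and the conclusion reads \<open>0 < 1\<close>; otherwise the bound is a real
  number.\<close>

lemma less_sparsity_boundD:
  assumes "ereal r < sparsity_bound ip \<tau>"
  shows "2 * r * coherence ip \<tau> < 1 + coherence ip \<tau>"
proof (cases "coherence ip \<tau> = 0")
  case False
  define M where "M = coherence ip \<tau>"
  have M: "M > 0"
    using False coherence_nonneg[of ip \<tau>] by (simp add: M_def)
  \<comment> \<open>The left side is a quotient of extended reals; as a cast it lets the whole bound
    be computed in the reals.\<close>
  have "1 / 2 = ereal (1 / 2)"
    by (metis ereal_divide numeral_eq_ereal one_ereal_def zero_neq_numeral)
  then have "sparsity_bound ip \<tau> = ereal (1 / 2 * (1 + 1 / M))"
    using M by (simp add: sparsity_bound_def M_def one_ereal_def)
  then have "r < 1 / 2 * (1 + 1 / M)"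
    using assms by simp
  then show ?thesis
    using M by (simp add: M_def[symmetric] field_simps)
qed simp

lemma l0_norm_diff_le: "l0_norm (d - c) \<le> l0_norm d + l0_norm c"
  for c d :: "'a::group_add ^ 'n::finite"
proof -
  have "card {j. (d - c) $ j \<noteq> 0} \<le> card ({j. d $ j \<noteq> 0} \<union> {j. c $ j \<noteq> 0})"
    by (intro card_mono) auto
  also have "\<dots> \<le> card {j. d $ j \<noteq> 0} + card {j. c $ j \<noteq> 0}"
    by (rule card_Un_le)
  finally show ?thesis
    by (simp add: l0_norm_def)
qed

context hilbert_cstar_module
begin

lemma ip_zero_left: "ip 0 y = 0"
  using ip_add_left[of 0 0 y] by simp

lemma ip_sum_left: "ip (\<Sum>j\<in>A. f j) y = (\<Sum>j\<in>A. ip (f j) y)"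
  by (induction A rule: infinite_finite_induct) (simp_all add: ip_zero_left ip_add_left)

lemma act_diff_left: "act (a - b) x = act a x - act b x"
  using act_add_left[of "a - b" b x] by (simp add: algebra_simps)

lemma synthesis_diff: "synthesis act \<tau> (d - c) = synthesis act \<tau> d - synthesis act \<tau> c"
  by (simp add: synthesis_def act_diff_left sum_subtractf)

lemma ip_synthesis_left: "ip (synthesis act \<tau> e) y = (\<Sum>j\<in>UNIV. e $ j * ip (\<tau> j) y)"
  by (simp add: synthesis_def ip_sum_left ip_act_left)

lemma norm_kernel_coeff_le:
  fixes e :: "'a ^ 'n::finite"
  assumes unit: "ip (\<tau> k) (\<tau> k) = 1"
    and ker: "synthesis act \<tau> e = 0"
  shows "(1 + coherence ip \<tau>) * norm (e $ k) \<le> coherence ip \<tau> * (\<Sum>j\<in>UNIV. norm (e $ j))"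
proof -
  let ?M = "coherence ip \<tau>"
  have "0 = (\<Sum>j\<in>UNIV. e $ j * ip (\<tau> j) (\<tau> k))"
    using ip_synthesis_left[of \<tau> e "\<tau> k"] by (simp add: ker ip_zero_left)
  also have "\<dots> = e $ k + (\<Sum>j\<in>UNIV - {k}. e $ j * ip (\<tau> j) (\<tau> k))"
    by (simp add: sum.remove[of UNIV k] unit)
  finally have "norm (e $ k) = norm (\<Sum>j\<in>UNIV - {k}. e $ j * ip (\<tau> j) (\<tau> k))"
    by (metis add_eq_0_iff norm_minus_cancel)
  also have "\<dots> \<le> (\<Sum>j\<in>UNIV - {k}. norm (e $ j) * ?M)"
  proof (rule sum_norm_le)
    fix j assume "j \<in> UNIV - {k}"
    then have "norm (ip (\<tau> j) (\<tau> k)) \<le> ?M"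
      by (simp add: norm_ip_le_coherence)
    then show "norm (e $ j * ip (\<tau> j) (\<tau> k)) \<le> norm (e $ j) * ?M"
      by (intro order_trans[OF norm_mult_ineq] mult_left_mono) auto
  qed
  \<comment> \<open>Moving the term \<open>?M * norm (e $ k)\<close> to the left then produces the
    factor \<open>1 + ?M\<close>.\<close>
  also have "\<dots> = ?M * ((\<Sum>j\<in>UNIV. norm (e $ j)) - norm (e $ k))"
    by (simp add: sum.remove[of UNIV k] sum_distrib_left mult.commute)
  finally show ?thesis
    by (simp add: algebra_simps)
qed

lemma l0_norm_kernel_ge:
  fixes e :: "'a ^ 'n::finite"
  assumes unit: "\<And>k. ip (\<tau> k) (\<tau> k) = 1"
    and ker: "synthesis act \<tau> e = 0"
    and "e \<noteq> 0"
  shows "1 + coherence ip \<tau> \<le> real (l0_norm e) * coherence ip \<tau>"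
proof -
  let ?M = "coherence ip \<tau>" and ?S = "\<Sum>j\<in>UNIV. norm (e $ j)" and ?T = "{j. e $ j \<noteq> 0}"
  obtain i where "e $ i \<noteq> 0"
    using \<open>e \<noteq> 0\<close> by (auto simp: vec_eq_iff)
  then have S: "?S > 0"
    by (intro sum_pos2[of UNIV i]) auto
  have "?S = (\<Sum>j\<in>?T. norm (e $ j))"
    by (rule sum.mono_neutral_right) auto
  then have "(1 + ?M) * ?S = (\<Sum>k\<in>?T. (1 + ?M) * norm (e $ k))"
    by (simp add: sum_distrib_left)
  \<comment> \<open>The sum runs over the support only, so the bound, constant in \<open>k\<close>,
    is counted \<open>l0_norm e\<close> times; \<open>?S > 0\<close> is cancelled at the
    end.\<close>
  also have "\<dots> \<le> (\<Sum>k\<in>?T. ?M * ?S)"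
    by (intro sum_mono norm_kernel_coeff_le unit ker)
  also have "\<dots> = real (l0_norm e) * ?M * ?S"
    by (simp add: l0_norm_def)
  finally show ?thesis
    using S by simp
qed

end

theorem theorem2p7:
  fixes act :: "'a::unital_cstar_algebra \<Rightarrow> 'e::ab_group_add \<Rightarrow> 'e"
    and ip :: "'e \<Rightarrow> 'e \<Rightarrow> 'a"
    and \<tau> :: "'n::finite \<Rightarrow> 'e"
    and x :: 'e
    and c :: "'a ^ 'n"
  assumes "hilbert_cstar_module act ip"
    and "finitely_generated act"
    and "unit_inner_product_frame ip \<tau>"
    and "x = synthesis act \<tau> c"
    and "ereal (real (l0_norm c)) < sparsity_bound ip \<tau>"
  shows "synthesis act \<tau> c = x \<and>
    (\<forall>d :: 'a ^ 'n. synthesis act \<tau> d = x \<and> d \<noteq> c \<longrightarrow> l0_norm d > l0_norm c)"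
proof (intro conjI allI impI)
  show "synthesis act \<tau> c = x"
    using assms(4) by simp
next
  interpret hilbert_cstar_module act ip
    by (rule assms(1))
  let ?M = "coherence ip \<tau>"
  fix d :: "'a ^ 'n"
  assume d: "synthesis act \<tau> d = x \<and> d \<noteq> c"
  show "l0_norm d > l0_norm c"
  proof (rule ccontr)
    assume "\<not> l0_norm d > l0_norm c"
    \<comment> \<open>The factor 2 meets the \<open>1 / 2\<close> in
      \<open>sparsity_bound\<close>.\<close>
    then have "real (l0_norm (d - c)) \<le> 2 * real (l0_norm c)"
      using l0_norm_diff_le[of d c] by linarith
    then have "real (l0_norm (d - c)) * ?M \<le> 2 * real (l0_norm c) * ?M"
      by (intro mult_right_mono coherence_nonneg)
    also have "\<dots> < 1 + ?M"
      by (rule less_sparsity_boundD[OF assms(5)])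
    \<comment> \<open>\<open>d - c\<close> is a nonzero kernel element, as both vectors synthesize
      \<open>x\<close>. This closes a chain with one strict step.\<close>
    also have "1 + ?M \<le> real (l0_norm (d - c)) * ?M"
      using assms(3,4) d
      by (intro l0_norm_kernel_ge) (simp_all add: unit_inner_product_frame_def synthesis_diff)
    finally show False
      by simp
  qed
qed

end
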